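(* Let $\alpha=4$. Then the coefficient matrix $(c_{n,k})_{(n,k)\in\mathbb{N}\times\mathbb{N}}$ of the Boţ–Nguyen acceleration with parameter $\alpha=4$ satisfies the Lorentz condition $$\lim_{n\to\infty}\sum_{k=0}^\infty|c_{n,k}-c_{n,k+1}|=0.$$ Consequently, if $X$ is a real Hilbert space, $T\colon X\to X$ is nonexpansive and linear, and $x_0\in X$, then the sequence $(x_n)_{n\in\mathbb{N}}$ generated by the Boţ–Nguyen acceleration with parameter $\alpha=4$ converges strongly (in norm) to $P_{\operatorname{Fix}T}x_0$.
   Context: $\mathbb{N}=\{0,1,2,\ldots\}$. Nonexpansive means $\|Tx-Ty\|\le\|x-y\|$ for all $x,y\in X$. $\operatorname{Fix}T=\{x\in X: Tx=x\}$, and $P_{\operatorname{Fix}T}$ is the orthogonal projection onto it. Boţ–Nguyen acceleration with parameter $\alpha$: set $x_1:=x_0$ and, for every $n\ge 1$, $$x_{n+1}:=\Big(1-\frac{\alpha}{2(n+\alpha)}\Big)x_n+\frac{\alpha}{2(n+\alpha)}Tx_n+\frac{n}{n+\alpha}(Tx_n-Tx_{n-1}).$$ Coefficients: by linearity $x_{n+1}=\sum_{k=0}^{\infty}c_{n,k}T^kx_0$ for all $n\in\mathbb{N}$, where $c_{n,k}:=0$ if $n<0$ or $k<0$ or $k>n$, where $$c_{0,0}=1,\quad c_{1,0}=\frac{2+\alpha}{2(1+\alpha)},\quad c_{1,1}=\frac{\alpha}{2(1+\alpha)},$$ and for all $n\ge 2$ and $k\in\{0,\ldots,n\}$, $$c_{n,k}=\frac{2n+\alpha}{2(n+\alpha)}c_{n-1,k}+\frac{2n+\alpha}{2(n+\alpha)}c_{n-1,k-1}-\frac{n}{n+\alpha}c_{n-2,k-1}.$$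 *)

theory Defs
  imports "HOL-Analysis.Analysis"
begin

definition nonexpansive :: "('a::real_normed_vector \<Rightarrow> 'a) \<Rightarrow> bool" where
  "nonexpansive T \<longleftrightarrow> (\<forall>x y. norm (T x - T y) \<le> norm (x - y))"

definition Fix :: "('a \<Rightarrow> 'a) \<Rightarrow> 'a set" where
  "Fix T = {x. T x = x}"

(* Orthogonal projection onto a linear subspace S.  The library's closest_point is
   restricted to heine_borel, i.e. to finite dimension, hence this definition.
   Such a p is unique (lemma orth_proj_eqI), and it exists whenever S is a closed
   subspace of a Hilbert space. *)
definition orth_proj :: "'a::real_inner set \<Rightarrow> 'a \<Rightarrow> 'a" where
  "orth_proj S x = (THE p. p \<in> S \<and> (\<forall>y\<in>S. orthogonal (x - p) y))"

lemma orth_proj_eqI: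
  fixes S :: "'a::real_inner set"
  assumes "subspace S" "p \<in> S" "\<And>y. y \<in> S \<Longrightarrow> orthogonal (x - p) y"
  shows "orth_proj S x = p"
  unfolding orth_proj_def
proof (rule the_equality)
  show "p \<in> S \<and> (\<forall>y\<in>S. orthogonal (x - p) y)"
    using assms by blast
next
  fix q assume q: "q \<in> S \<and> (\<forall>y\<in>S. orthogonal (x - q) y)"
  have d: "q - p \<in> S"
    using q assms by (simp add: subspace_diff)
  have "(x - p) \<bullet> (q - p) = 0" "(x - q) \<bullet> (q - p) = 0"
    using d q assms(3) by (auto simp: orthogonal_def)
  then have "(q - p) \<bullet> (q - p) = 0"
    by (simp add: inner_diff_left)
  then show "q = p"
    by simp
qed

fun bn_iter :: "real \<Rightarrow> ('a::real_vector \<Rightarrow> 'a) \<Rightarrow> 'a \<Rightarrow> nat \<Rightarrow> 'a" where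
  "bn_iter \<alpha> T x\<^sub>0 0 = x\<^sub>0"
| "bn_iter \<alpha> T x\<^sub>0 (Suc 0) = x\<^sub>0"
| "bn_iter \<alpha> T x\<^sub>0 (Suc (Suc m)) =
     (let n = real (Suc m); x = bn_iter \<alpha> T x\<^sub>0 (Suc m); x' = bn_iter \<alpha> T x\<^sub>0 m in
        (1 - \<alpha> / (2 * (n + \<alpha>))) *\<^sub>R x + (\<alpha> / (2 * (n + \<alpha>))) *\<^sub>R T x
          + (n / (n + \<alpha>)) *\<^sub>R (T x - T x'))"

lemma bn_iter_rec:
  assumes "n \<ge> 1"
  shows "bn_iter \<alpha> T x\<^sub>0 (n + 1) =
     (1 - \<alpha> / (2 * (real n + \<alpha>))) *\<^sub>R bn_iter \<alpha> T x\<^sub>0 n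
     + (\<alpha> / (2 * (real n + \<alpha>))) *\<^sub>R T (bn_iter \<alpha> T x\<^sub>0 n)
     + (real n / (real n + \<alpha>)) *\<^sub>R (T (bn_iter \<alpha> T x\<^sub>0 n) - T (bn_iter \<alpha> T x\<^sub>0 (n - 1)))"
  using assms by (cases n) (simp_all add: Let_def)

(* bn_coeff \<alpha> n k is the coefficient of T^k x_0 in the iterate of index n + 1
   (not n), see bn_iter_eq_sum_bn_coeff.  The tests k = 0 stand for c_{n,-1} = 0. *)
fun bn_coeff :: "real \<Rightarrow> nat \<Rightarrow> nat \<Rightarrow> real" where
  "bn_coeff \<alpha> 0 k = (if k = 0 then 1 else 0)"
| "bn_coeff \<alpha> (Suc 0) k =
     (if k = 0 then (2 + \<alpha>) / (2 * (1 + \<alpha>))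
      else if k = 1 then \<alpha> / (2 * (1 + \<alpha>)) else 0)"
| "bn_coeff \<alpha> (Suc (Suc m)) k =
     (let n = real (Suc (Suc m)) in
      if k \<le> Suc (Suc m) then
        (2 * n + \<alpha>) / (2 * (n + \<alpha>)) * bn_coeff \<alpha> (Suc m) k
        + (2 * n + \<alpha>) / (2 * (n + \<alpha>)) * (if k = 0 then 0 else bn_coeff \<alpha> (Suc m) (k - 1))
        - n / (n + \<alpha>) * (if k = 0 then 0 else bn_coeff \<alpha> m (k - 1))
      else 0)"

lemma bn_coeff_eq_0: "k > n \<Longrightarrow> bn_coeff \<alpha> n k = 0"
  by (induction \<alpha> n k rule: bn_coeff.induct) (simp_all add: Let_def)

lemma bn_coeff_diff_summable: "summable (\<lambda>k. \<bar>bn_coeff \<alpha> n k - bn_coeff \<alpha> n (k + 1)\<bar>)"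
  by (rule summable_finite[of "{..n}"]) (auto simp: bn_coeff_eq_0)

lemma bn_iter_eq_sum_bn_coeff:
  fixes T :: "'a::real_vector \<Rightarrow> 'a"
  assumes "linear T" "\<alpha> > 0"
  shows "bn_iter \<alpha> T x\<^sub>0 (n + 1) = (\<Sum>k\<le>n. bn_coeff \<alpha> n k *\<^sub>R (T ^^ k) x\<^sub>0)"
proof (induction n rule: less_induct)
  case (less n)
  consider "n = 0" | "n = 1" | m where "n = Suc (Suc m)"
    by (metis One_nat_def not0_implies_Suc)
  then show ?case
  proof cases
    case 1
    then show ?thesis by simp
  next
    case 2
    have "1 - \<alpha> / (2 * (1 + \<alpha>)) = (2 + \<alpha>) / (2 * (1 + \<alpha>))"
      using assms(2) by (simp add: field_simps)
    with 2 show ?thesis by (simp add: Let_def)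
  next
    case (3 m)
    define N where "N = real (Suc (Suc m))"
    define a where "a = (2 * N + \<alpha>) / (2 * (N + \<alpha>))"
    define b where "b = N / (N + \<alpha>)"
    have N: "N + \<alpha> > 0" using assms(2) by (simp add: N_def)
    have "b = 2 * N / (2 * (N + \<alpha>))"
      unfolding b_def by (rule mult_divide_mult_cancel_left[symmetric]) simp
    then have "a - b = \<alpha> / (2 * (N + \<alpha>))"
      by (simp add: a_def flip: diff_divide_distrib)
    moreover have "1 - \<alpha> / (2 * (N + \<alpha>)) = a"
      using N by (simp add: a_def field_simps)
    ultimately have ab: "1 - \<alpha> / (2 * (N + \<alpha>)) = a" "\<alpha> / (2 * (N + \<alpha>)) = a - b"
      by simp_all
    let ?u = "\<lambda>k. (T ^^ k) x\<^sub>0"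
    let ?x = "bn_iter \<alpha> T x\<^sub>0 (Suc (Suc m))" and ?y = "bn_iter \<alpha> T x\<^sub>0 (Suc m)"
    have x: "?x = (\<Sum>k\<le>Suc m. bn_coeff \<alpha> (Suc m) k *\<^sub>R ?u k)"
      using less[of "Suc m"] 3 by simp
    have y: "?y = (\<Sum>k\<le>m. bn_coeff \<alpha> m k *\<^sub>R ?u k)"
      using less[of m] 3 by simp
    have Tx: "T ?x = (\<Sum>k\<le>Suc m. bn_coeff \<alpha> (Suc m) k *\<^sub>R ?u (Suc k))"
      unfolding x by (simp add: linear_sum[OF assms(1)] linear_scale[OF assms(1)] linear_add[OF assms(1)]
          del: sum.atMost_Suc bn_iter.simps bn_coeff.simps)
    have Ty: "T ?y = (\<Sum>k\<le>Suc m. bn_coeff \<alpha> m k *\<^sub>R ?u (Suc k))"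
      unfolding y by (simp add: linear_sum[OF assms(1)] linear_scale[OF assms(1)] bn_coeff_eq_0)
    have xx: "?x = (\<Sum>k\<le>Suc (Suc m). bn_coeff \<alpha> (Suc m) k *\<^sub>R ?u k)"
      unfolding x by (simp add: bn_coeff_eq_0[of "Suc m" "Suc (Suc m)"]
          del: bn_coeff.simps funpow.simps)
    have "bn_iter \<alpha> T x\<^sub>0 (n + 1) = a *\<^sub>R ?x + (a - b) *\<^sub>R T ?x + b *\<^sub>R (T ?x - T ?y)"
      using 3 ab by (simp add: Let_def N_def b_def)
    also have "\<dots> = a *\<^sub>R ?x + (a *\<^sub>R T ?x - b *\<^sub>R T ?y)"
      by (simp add: algebra_simps del: bn_iter.simps)
    also have "a *\<^sub>R T ?x - b *\<^sub>R T ?y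
        = (\<Sum>k\<le>Suc m. (a * bn_coeff \<alpha> (Suc m) k - b * bn_coeff \<alpha> m k) *\<^sub>R ?u (Suc k))"
      unfolding Tx Ty scaleR_sum_right sum_subtractf[symmetric]
      by (intro sum.cong refl) (simp add: scaleR_diff_left del: bn_coeff.simps)
    also have "a *\<^sub>R ?x + \<dots> = (\<Sum>k\<le>Suc (Suc m). bn_coeff \<alpha> (Suc (Suc m)) k *\<^sub>R ?u k)"
    proof -
      have "a *\<^sub>R ?x = (a * bn_coeff \<alpha> (Suc m) 0) *\<^sub>R ?u 0
          + (\<Sum>k\<le>Suc m. (a * bn_coeff \<alpha> (Suc m) (Suc k)) *\<^sub>R ?u (Suc k))"
        unfolding xx scaleR_sum_right
        by (subst sum.atMost_Suc_shift) (simp del: sum.atMost_Suc bn_coeff.simps)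
      moreover have "bn_coeff \<alpha> (Suc (Suc m)) 0 = a * bn_coeff \<alpha> (Suc m) 0"
        by (simp add: Let_def a_def N_def)
      moreover have "bn_coeff \<alpha> (Suc (Suc m)) (Suc k) = a * bn_coeff \<alpha> (Suc m) (Suc k)
          + (a * bn_coeff \<alpha> (Suc m) k - b * bn_coeff \<alpha> m k)" if "k \<le> Suc m" for k
        using that by (simp add: Let_def a_def b_def N_def)
      ultimately show ?thesis
        by (subst sum.atMost_Suc_shift)
          (simp add: sum.distrib scaleR_add_left add.assoc del: sum.atMost_Suc bn_coeff.simps)
    qed
    finally show ?thesis
      using 3 by simp
  qed
qed

end

theory Submission
  imports Defs "HOL-Real_Asymp.Real_Asymp"
begin

text \<open>
  For \<open>\<alpha> = 4\<close> the coefficients have a closed form.  Put \<open>p\<^sub>n(z) = (\<Sum>k\<le>n. c\<^sub>n\<^sub>k z^k)\<close>; then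
  \<open>(n + 4) p\<^sub>n = (n + 2)(1 + z) p\<^sub>n\<^sub>-\<^sub>1 - n z p\<^sub>n\<^sub>-\<^sub>2\<close> for \<open>n \<ge> 1\<close>, if one puts
  \<open>p\<^sub>-\<^sub>1 = 1\<close>.  The recurrence turns into a first-order linear differential equation for
  \<open>F(t) = (\<Sum>n. p\<^sub>n(z) t^n)\<close>.  Its integrating factor is the rational function \<open>t^4 / ((1 - t)(1 - z t))\<close>, so that
  \<open>F(t) = (1 - t)(1 - z t) (\<Sum>m. t^m / (m + 4) (\<Sum>j\<le>m. (m - j + 1)(3 j + 4) z^j))\<close>.
  Multiplying out, \<open>c\<^sub>n\<^sub>k\<close> is a combination of four neighbouring values of
  \<open>(m - j + 1)(3 j + 4) / (m + 4)\<close> which collapses to the nonnegative quadratic of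
  \<open>bn_coeff_4\<close> for \<open>1 \<le> k \<le> n\<close>, with a different value at \<open>k = 0\<close>.  Neighbouring
  coefficients therefore differ by \<open>O(1 / n\<^sup>2)\<close> only, and the row contains \<open>n + 1\<close> of them:
  this is the Lorentz condition.

  Convergence of the iterates is then a mean ergodic theorem for averages \<open>\<Sum>k. c\<^sub>n\<^sub>k T^k\<close> with
  nonnegative weights of sum \<open>1\<close>.  On vectors \<open>w - T w\<close> a summation by parts bounds the average
  by the sum in the Lorentz condition; the averages are contractions, so they tend to zero on the
  closure of the range of \<open>I - T\<close>; and they fix the fixed points of \<open>T\<close>.  In a Hilbert space
  these two closed subspaces are orthogonal complements of each other
  (\<open>fixed_point_if_orthogonal_range\<close>, \<open>fixed_point_orthogonal_range\<close>).
\<close>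

section \<open>Closed form of the coefficients\<close>

lemma bn_coeff_4_rec:
  assumes "k \<le> m + 2"
  shows "(real m + 6) * bn_coeff 4 (Suc (Suc m)) k =
    (real m + 4) * (bn_coeff 4 (Suc m) k + (if k = 0 then 0 else bn_coeff 4 (Suc m) (k - 1)))
    - (real m + 2) * (if k = 0 then 0 else bn_coeff 4 m (k - 1))"
proof -
  have a: "(2 * (real m + 2) + 4) / (2 * (real m + 2 + 4)) = (real m + 4) / (real m + 6)"
    by (simp add: divide_simps) (simp add: algebra_simps)
  define u where "u = bn_coeff 4 (Suc m) k"
  define v where "v = (if k = 0 then 0 else bn_coeff 4 (Suc m) (k - 1))"
  define w where "w = (if k = 0 then 0 else bn_coeff 4 m (k - 1))"
  have "bn_coeff 4 (Suc (Suc m)) k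
      = (2 * (real m + 2) + 4) / (2 * (real m + 2 + 4)) * u
        + (2 * (real m + 2) + 4) / (2 * (real m + 2 + 4)) * v
        - (real m + 2) / (real m + 2 + 4) * w"
    using assms by (simp add: Let_def u_def v_def w_def add_ac)
  then have "bn_coeff 4 (Suc (Suc m)) k
      = (real m + 4) / (real m + 6) * u + (real m + 4) / (real m + 6) * v
        - (real m + 2) / (real m + 6) * w"
    unfolding a by simp
  then have "(real m + 6) * bn_coeff 4 (Suc (Suc m)) k = (real m + 4) * (u + v) - (real m + 2) * w"
    by (simp add: divide_simps del: bn_coeff.simps) (simp add: algebra_simps del: bn_coeff.simps)
  then show ?thesis unfolding u_def v_def w_def .
qed

text \<open>The numerator of \<open>c\<^sub>n\<^sub>k\<close> over the common denominator \<open>(n + 2)(n + 3)(n + 4)\<close>.  The column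
  \<open>k = 0\<close> deviates from the quadratic because the factor \<open>1 - z t\<close> of the generating function
  would draw on values at \<open>j = -1\<close>, where the polynomial \<open>(m - j + 1)(3 j + 4)\<close> does not vanish
  but the coefficient does.\<close>

definition bn4_num :: "nat \<Rightarrow> nat \<Rightarrow> real" where
  "bn4_num n k =
     (if k = 0 then 12 * (real n + 2)
      else if k \<le> n then 2 * (real n - real k) * (3 * real k + 1) + 8 * (real n + 2)
      else 0)"

text \<open>The recurrence of the coefficients, multiplied by \<open>(m + 3)(m + 4)(m + 5)\<close>: a polynomial
  identity in the interior, checked separately at the columns \<open>k = 0\<close> and \<open>k = 1\<close>, where \<open>k - 1\<close>
  meets the exceptional column, and at \<open>k = m + 2\<close>, where the earlier rows have ended.\<close>

lemma bn4_num_rec: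
  assumes "k \<le> m + 2"
  shows "(real m + 3) * bn4_num (Suc (Suc m)) k =
    (real m + 4) * (bn4_num (Suc m) k + (if k = 0 then 0 else bn4_num (Suc m) (k - 1)))
    - (real m + 5) * (if k = 0 then 0 else bn4_num m (k - 1))"
proof -
  consider "k = 0" | "k = 1" | j where "k = Suc (Suc j)" "j < m" | "k = Suc (Suc m)"
    using assms by (metis One_nat_def add_2_eq_Suc' le_neq_implies_less not0_implies_Suc Suc_less_eq)
  then show ?thesis
    by cases (auto simp: bn4_num_def algebra_simps)
qed

lemma bn_coeff_4:
  "bn_coeff 4 n k = bn4_num n k / ((real n + 2) * (real n + 3) * (real n + 4))"
proof (induction n arbitrary: k rule: less_induct)
  case (less n)
  consider "n = 0" | "n = 1" | m where "n = Suc (Suc m)" "k \<le> n" | "k > n"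
    by (metis One_nat_def not0_implies_Suc not_le)
  then show ?case
  proof cases
    case 3
    define D where "D = (real m + 3) * (real m + 4) * (real m + 5)"
    have c1: "bn_coeff 4 (Suc m) j = bn4_num (Suc m) j / D" for j
      using less[of "Suc m" j] 3 by (simp add: D_def add_ac)
    have c0: "(real m + 2) * bn_coeff 4 m j = (real m + 5) * bn4_num m j / D" for j
      using less[of m j] 3 by (simp add: D_def divide_simps mult_ac)
    have k: "k \<le> m + 2" using 3 by simp
    let ?V = "if k = 0 then 0 else bn4_num (Suc m) (k - 1)"
    let ?W = "if k = 0 then 0 else bn4_num m (k - 1)"
    have V: "(if k = 0 then 0 else bn_coeff 4 (Suc m) (k - 1)) = ?V / D"
      using c1 by simp
    have W: "(real m + 2) * (if k = 0 then 0 else bn_coeff 4 m (k - 1)) = (real m + 5) * ?W / D"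
      using c0 by simp
    have "(real m + 6) * bn_coeff 4 n k
        = (real m + 4) * (bn4_num (Suc m) k / D + ?V / D) - (real m + 5) * ?W / D"
      using bn_coeff_4_rec[OF k, unfolded V W c1] 3 by simp
    also have "\<dots> = ((real m + 4) * (bn4_num (Suc m) k + ?V) - (real m + 5) * ?W) / D"
      by (simp only: diff_divide_distrib add_divide_distrib times_divide_eq_right distrib_left)
    also have "\<dots> = (real m + 3) * bn4_num n k / D"
      using bn4_num_rec[OF k] 3 by simp
    finally have "(real m + 6) * bn_coeff 4 n k = (real m + 3) * bn4_num n k / D" .
    then have "bn_coeff 4 n k = (real m + 3) * bn4_num n k / D / (real m + 6)"
      using nonzero_mult_div_cancel_left[of "real m + 6" "bn_coeff 4 n k"] by simp
    also have "\<dots> = bn4_num n k / ((real m + 4) * (real m + 5) * (real m + 6))"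
      by (simp add: D_def)
    also have "\<dots> = bn4_num n k / ((real n + 2) * (real n + 3) * (real n + 4))"
      using 3 by (simp add: add_ac)
    finally show ?thesis .
  qed (auto simp: bn4_num_def bn_coeff_eq_0)
qed


lemma bn_coeff_4_nonneg: "bn_coeff 4 n k \<ge> 0"
  unfolding bn_coeff_4 bn4_num_def
  by (auto intro!: divide_nonneg_nonneg add_nonneg_nonneg mult_nonneg_nonneg)

text \<open>The numerator is quadratic in \<open>k\<close> with differences of order \<open>n\<close>, against a
  denominator of order \<open>n\<^sup>3\<close>.  The jump at \<open>k = 0\<close> and
  the cut-off at \<open>k = n\<close> have the same order.  Equality holds for \<open>n = k = 0\<close>.\<close>

lemma bn_coeff_4_diff_le:
  "\<bar>bn_coeff 4 n k - bn_coeff 4 n (k + 1)\<bar> \<le> 12 / ((real n + 3) * (real n + 4))"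
proof -
  have "\<bar>bn4_num n k - bn4_num n (k + 1)\<bar> \<le> 12 * (real n + 2)"
  proof -
    consider "k > n" | "k = n" | "k = 0" "k < n" | "1 \<le> k" "k < n"
      by linarith
    then show ?thesis
    proof cases
      case 4
      have "bn4_num n k - bn4_num n (k + 1) = 2 * (6 * real k + 4 - 3 * real n)"
        using 4 by (simp add: bn4_num_def algebra_simps)
      moreover have "real k < real n" using 4 by simp
      ultimately show ?thesis by (simp add: abs_le_iff)
    qed (auto simp: bn4_num_def abs_le_iff)
  qed
  then have "\<bar>bn4_num n k - bn4_num n (k + 1)\<bar> / ((real n + 2) * (real n + 3) * (real n + 4))
      \<le> 12 * (real n + 2) / ((real n + 2) * (real n + 3) * (real n + 4))"
    by (intro divide_right_mono) auto
  also have "\<dots> = 12 / ((real n + 3) * (real n + 4))"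
    using mult_divide_mult_cancel_left[of "real n + 2" 12 "(real n + 3) * (real n + 4)"]
    by (simp add: mult_ac)
  finally show ?thesis
    by (simp add: bn_coeff_4 abs_mult flip: diff_divide_distrib)
qed

lemma bn_coeff_4_Lorentz:
  "(\<lambda>n. \<Sum>k. \<bar>bn_coeff 4 n k - bn_coeff 4 n (k + 1)\<bar>) \<longlonglongrightarrow> 0"
proof (rule tendsto_sandwich[where f = "\<lambda>_. 0" and h = "\<lambda>n. 12 / (real n + 4)"])
  have "(\<Sum>k. \<bar>bn_coeff 4 n k - bn_coeff 4 n (k + 1)\<bar>) \<le> 12 / (real n + 4)" for n
  proof -
    have "(\<Sum>k. \<bar>bn_coeff 4 n k - bn_coeff 4 n (k + 1)\<bar>)
        = (\<Sum>k\<le>n. \<bar>bn_coeff 4 n k - bn_coeff 4 n (k + 1)\<bar>)"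
      by (rule suminf_finite) (auto simp: bn_coeff_eq_0)
    also have "\<dots> \<le> (\<Sum>k\<le>n. 12 / ((real n + 3) * (real n + 4)))"
      by (rule sum_mono) (rule bn_coeff_4_diff_le)
    also have "\<dots> \<le> 12 / (real n + 4)"
      by (simp add: divide_simps)
    finally show ?thesis .
  qed
  then show "\<forall>\<^sub>F n in sequentially.
      (\<Sum>k. \<bar>bn_coeff 4 n k - bn_coeff 4 n (k + 1)\<bar>) \<le> 12 / (real n + 4)"
    by simp
  show "\<forall>\<^sub>F n in sequentially. 0 \<le> (\<Sum>k. \<bar>bn_coeff 4 n k - bn_coeff 4 n (k + 1)\<bar>)"
    by (intro always_eventually allI suminf_nonneg bn_coeff_diff_summable) simp
  show "(\<lambda>n. 12 / (real n + 4)) \<longlonglongrightarrow> 0"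
    by real_asymp
qed simp

section \<open>Orthogonal decomposition of a Hilbert space along the fixed points\<close>

text \<open>The variational argument behind both orthogonality statements below: near \<open>s = 0\<close> the linear
  term dominates and changes sign.\<close>

lemma linear_term_zero_if_nonneg:
  fixes a b :: real
  assumes "\<And>s. 0 \<le> s * a + s\<^sup>2 * b"
  shows "a = 0"
proof -
  define q where "q = 1 + \<bar>b\<bar>"
  have q: "q > 0" by (simp add: q_def)
  have "0 \<le> - (a / q) * a + (- (a / q))\<^sup>2 * b" by (rule assms)
  also have "\<dots> = a\<^sup>2 * (b - q) / q\<^sup>2"
    using q by (simp add: field_simps power2_eq_square)
  finally have "0 \<le> a\<^sup>2 * (b - q)"
    using q by (simp add: zero_le_divide_iff)
  moreover have "a\<^sup>2 * (b - q) \<le> a\<^sup>2 * (- 1)"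
    by (intro mult_left_mono) (auto simp: q_def)
  ultimately have "a\<^sup>2 \<le> 0" by linarith
  then show ?thesis by simp
qed

text \<open>A minimizing sequence for the distance to \<open>S\<close> is a Cauchy sequence by the parallelogram law,
  and its limit is the projection.  Since the limit is only claimed to lie in the closure, \<open>S\<close>
  itself may be any subspace, such as the range of \<open>I - T\<close>.\<close>

lemma orthogonal_projection_closure_exists:
  fixes S :: "'a::{real_inner, complete_space} set"
  assumes "subspace S"
  obtains y where "y \<in> closure S" "\<And>v. v \<in> S \<Longrightarrow> orthogonal (x - y) v"
proof -
  define \<delta> where "\<delta> = (INF y\<in>S. (norm (x - y))\<^sup>2)"
  have bdd: "bdd_below ((\<lambda>y. (norm (x - y))\<^sup>2) ` S)"
    by (rule bdd_belowI[of _ 0]) auto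
  have ne: "S \<noteq> {}" using subspace_0[OF assms] by blast
  have lb: "\<delta> \<le> (norm (x - y))\<^sup>2" if "y \<in> S" for y
    unfolding \<delta>_def by (rule cINF_lower[OF bdd that])
  have "\<exists>y\<in>S. (norm (x - y))\<^sup>2 < \<delta> + inverse (real (Suc n))" for n
    using cINF_less_iff[OF ne bdd, of "\<delta> + inverse (real (Suc n))"] by (simp add: \<delta>_def)
  then obtain Y where Y: "\<And>n. Y n \<in> S" "\<And>n. (norm (x - Y n))\<^sup>2 < \<delta> + inverse (real (Suc n))"
    by metis
  \<comment> \<open>The parallelogram law for \<open>x - y\<close> and \<open>x - z\<close>; the midpoint of \<open>y\<close> and \<open>z\<close> lies in \<open>S\<close>.\<close>
  have par: "(norm (y - z))\<^sup>2 \<le> 2 * ((norm (x - y))\<^sup>2 - \<delta>) + 2 * ((norm (x - z))\<^sup>2 - \<delta>)"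
    if "y \<in> S" "z \<in> S" for y z
  proof -
    have "(1/2) *\<^sub>R (y + z) \<in> S"
      using that assms by (intro subspace_scale subspace_add)
    then have "\<delta> \<le> (norm (x - (1/2) *\<^sub>R (y + z)))\<^sup>2" by (rule lb)
    moreover have "(norm (y - z))\<^sup>2 + 4 * (norm (x - (1/2) *\<^sub>R (y + z)))\<^sup>2
        = 2 * (norm (x - y))\<^sup>2 + 2 * (norm (x - z))\<^sup>2"
      unfolding power2_norm_eq_inner
      by (simp add: inner_diff_left inner_diff_right inner_add_left inner_add_right
          inner_commute algebra_simps)
    ultimately show ?thesis by simp
  qed
  have "Cauchy Y"
  proof (rule CauchyI)
    fix e :: real assume e: "e > 0"
    then obtain N where N: "inverse (real (Suc N)) < e\<^sup>2 / 4"
      using reals_Archimedean[of "e\<^sup>2 / 4"] by auto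
    have "norm (Y m - Y n) < e" if "m \<ge> N" "n \<ge> N" for m n
    proof -
      have near: "(norm (x - Y j))\<^sup>2 - \<delta> < e\<^sup>2 / 4" if "j \<ge> N" for j
      proof -
        have "inverse (real (Suc j)) \<le> inverse (real (Suc N))"
          using that by (intro le_imp_inverse_le) auto
        with N have "inverse (real (Suc j)) < e\<^sup>2 / 4" by (rule le_less_trans[rotated])
        moreover have "(norm (x - Y j))\<^sup>2 - \<delta> < inverse (real (Suc j))"
          using Y(2)[of j] by (simp only: diff_less_eq add.commute)
        ultimately show ?thesis by (rule less_trans[rotated])
      qed
      have "(norm (Y m - Y n))\<^sup>2
          \<le> 2 * ((norm (x - Y m))\<^sup>2 - \<delta>) + 2 * ((norm (x - Y n))\<^sup>2 - \<delta>)"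
        by (rule par[OF Y(1) Y(1)])
      also have "\<dots> < 2 * (e\<^sup>2 / 4) + 2 * (e\<^sup>2 / 4)"
        by (intro add_strict_mono mult_strict_left_mono near that) simp_all
      also have "\<dots> = e\<^sup>2" by simp
      finally have "(norm (Y m - Y n))\<^sup>2 < e\<^sup>2" .
      then show ?thesis
        using e by (simp add: power2_less_imp_less)
    qed
    then show "\<exists>M. \<forall>m\<ge>M. \<forall>n\<ge>M. norm (Y m - Y n) < e" by blast
  qed
  then obtain y where y: "Y \<longlonglongrightarrow> y"
    using Cauchy_convergent convergent_def by blast
  show thesis
  proof
    show "y \<in> closure S"
      using y Y(1) closure_sequential by blast
  next
    fix v assume v: "v \<in> S"
    have "(\<lambda>n. (norm (x - Y n))\<^sup>2) \<longlonglongrightarrow> (norm (x - y))\<^sup>2"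
      by (intro tendsto_intros y)
    moreover have "(\<lambda>n. \<delta> + inverse (real (Suc n))) \<longlonglongrightarrow> \<delta> + 0"
      by (intro tendsto_intros LIMSEQ_inverse_real_of_nat)
    ultimately have "(norm (x - y))\<^sup>2 \<le> \<delta> + 0"
      by (rule LIMSEQ_le) (use Y(2) less_imp_le in blast)
    then have le: "(norm (x - y))\<^sup>2 \<le> \<delta>" by simp
    have "0 \<le> s * (- 2 * ((x - y) \<bullet> v)) + s\<^sup>2 * (v \<bullet> v)" for s
    proof -
      have "\<delta> \<le> (norm (x - (Y n + s *\<^sub>R v)))\<^sup>2" for n
        using v Y(1) assms by (intro lb subspace_add subspace_scale)
      moreover have "(\<lambda>n. (norm (x - (Y n + s *\<^sub>R v)))\<^sup>2) \<longlonglongrightarrow> (norm (x - (y + s *\<^sub>R v)))\<^sup>2"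
        by (intro tendsto_intros y)
      ultimately have "\<delta> \<le> (norm (x - (y + s *\<^sub>R v)))\<^sup>2"
        by (meson LIMSEQ_le_const)
      with le have "(norm (x - y))\<^sup>2 \<le> (norm ((x - y) - s *\<^sub>R v))\<^sup>2"
        unfolding diff_diff_add by (rule order_trans)
      then show ?thesis
        unfolding power2_norm_eq_inner
        by (simp add: inner_diff_left inner_diff_right inner_commute algebra_simps
            power2_eq_square)
    qed
    then have "- 2 * ((x - y) \<bullet> v) = 0"
      by (rule linear_term_zero_if_nonneg)
    then show "orthogonal (x - y) v" by (simp add: orthogonal_def)
  qed
qed

lemma nonexpansive_linear_norm_le:
  assumes "nonexpansive T" "linear T"
  shows "norm (T z) \<le> norm z"
  using assms linear_0[OF assms(2)] unfolding nonexpansive_def by (metis diff_zero)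

text \<open>If \<open>p\<close> is orthogonal to \<open>p - T p\<close>, then \<open>norm (T p - p)\<^sup>2 = norm (T p)\<^sup>2 - norm p\<^sup>2\<close>, which
  is not positive for a contraction.  This replaces the usual detour through the adjoint of
  \<open>T\<close>.\<close>

lemma fixed_point_if_orthogonal_range:
  fixes T :: "'a::real_inner \<Rightarrow> 'a"
  assumes "nonexpansive T" "linear T" "orthogonal p (p - T p)"
  shows "T p = p"
proof -
  have "p \<bullet> T p = p \<bullet> p"
    using assms(3) by (simp add: orthogonal_def inner_diff_right)
  moreover have "T p \<bullet> T p \<le> p \<bullet> p"
    using nonexpansive_linear_norm_le[OF assms(1,2), of p] by (simp add: norm_le)
  ultimately have "(T p - p) \<bullet> (T p - p) \<le> 0"
    by (simp add: inner_diff_left inner_diff_right inner_commute)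
  then show ?thesis by (metis eq_iff_diff_eq_0 inner_ge_zero inner_eq_zero_iff order_antisym)
qed

text \<open>Expand \<open>norm (T (f + s z))\<^sup>2 \<le> norm (f + s z)\<^sup>2\<close>: the constant terms cancel, and the
  linear term in \<open>s\<close> has to vanish.\<close>

lemma fixed_point_orthogonal_range:
  fixes T :: "'a::real_inner \<Rightarrow> 'a"
  assumes "nonexpansive T" "linear T" "T f = f"
  shows "orthogonal f (z - T z)"
proof -
  have "0 \<le> s * (2 * (f \<bullet> (z - T z))) + s\<^sup>2 * (z \<bullet> z - T z \<bullet> T z)" for s
  proof -
    have "T (f + s *\<^sub>R z) = f + s *\<^sub>R T z"
      using assms by (simp add: linear_add linear_scale)
    then have "(f + s *\<^sub>R T z) \<bullet> (f + s *\<^sub>R T z) \<le> (f + s *\<^sub>R z) \<bullet> (f + s *\<^sub>R z)"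
      using nonexpansive_linear_norm_le[OF assms(1,2), of "f + s *\<^sub>R z"] by (simp add: norm_le)
    then show ?thesis
      by (simp add: inner_add_left inner_add_right inner_diff_right inner_commute
          algebra_simps power2_eq_square)
  qed
  then have "2 * (f \<bullet> (z - T z)) = 0"
    by (rule linear_term_zero_if_nonneg)
  then show ?thesis by (simp add: orthogonal_def)
qed

lemma subspace_Fix:
  assumes "linear T"
  shows "subspace (Fix T)"
  unfolding Fix_def subspace_def
  using assms by (auto simp: linear_0 linear_add linear_scale)

lemma hilbert_fixed_point_decomposition:
  fixes T :: "'a::{real_inner, complete_space} \<Rightarrow> 'a"
  assumes "nonexpansive T" "linear T"
  shows "orth_proj (Fix T) x \<in> Fix T"
    and "x - orth_proj (Fix T) x \<in> closure (range (\<lambda>w. w - T w))"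
proof -
  have "linear (\<lambda>w. w - T w)"
    using assms(2) linear_compose_sub[OF linear_id assms(2)] by simp
  then have "subspace (range (\<lambda>w. w - T w))"
    by (intro linear_subspace_image) auto
  then obtain y where y: "y \<in> closure (range (\<lambda>w. w - T w))"
    "\<And>v. v \<in> range (\<lambda>w. w - T w) \<Longrightarrow> orthogonal (x - y) v"
    using orthogonal_projection_closure_exists[of _ x] by metis
  define p where "p = x - y"
  have p: "p \<in> Fix T"
    using y(2) fixed_point_if_orthogonal_range[OF assms, of p] by (auto simp: Fix_def p_def)
  have "orthogonal (x - p) f" if f: "f \<in> Fix T" for f
  proof -
    have "closure (range (\<lambda>w. w - T w)) \<subseteq> {u. f \<bullet> u = 0}"
      using f fixed_point_orthogonal_range[OF assms, of f]
      by (intro closure_minimal closed_hyperplane) (auto simp: Fix_def orthogonal_def)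
    then show ?thesis using y(1) by (auto simp: p_def orthogonal_def inner_commute)
  qed
  then have "orth_proj (Fix T) x = p"
    using orth_proj_eqI[OF subspace_Fix[OF assms(2)] p] by blast
  then show "orth_proj (Fix T) x \<in> Fix T"
    and "x - orth_proj (Fix T) x \<in> closure (range (\<lambda>w. w - T w))"
    using p y(1) by (simp_all add: p_def)
qed

section \<open>A mean ergodic theorem for weights with the Lorentz condition\<close>

lemma sum_scaleR_by_parts:
  fixes a :: "nat \<Rightarrow> real" and z :: "nat \<Rightarrow> 'a::real_vector"
  shows "(\<Sum>k\<le>n. a k *\<^sub>R (z k - z (Suc k)))
    = a 0 *\<^sub>R z 0 - (\<Sum>k\<le>n. (a k - a (Suc k)) *\<^sub>R z (Suc k)) - a (Suc n) *\<^sub>R z (Suc n)"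
  by (induction n) (simp_all add: algebra_simps)

text \<open>The averages \<open>A n\<close> are contractions, are the identity on the fixed points, and tend to zero
  on the range of \<open>I - T\<close>, hence on its closure; the decomposition of \<open>x\<close> does the rest.\<close>

lemma mean_ergodic_Lorentz:
  fixes T :: "'a::{real_inner, complete_space} \<Rightarrow> 'a" and c :: "nat \<Rightarrow> nat \<Rightarrow> real"
  assumes T: "nonexpansive T" "linear T"
    and nonneg: "\<And>n k. c n k \<ge> 0" and zero: "\<And>n k. k > n \<Longrightarrow> c n k = 0"
    and sum1: "\<And>n. (\<Sum>k\<le>n. c n k) = 1"
    and Lorentz: "(\<lambda>n. \<Sum>k. \<bar>c n k - c n (k + 1)\<bar>) \<longlonglongrightarrow> 0"
  shows "(\<lambda>n. \<Sum>k\<le>n. c n k *\<^sub>R (T ^^ k) x) \<longlonglongrightarrow> orth_proj (Fix T) x"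
proof -
  define A where "A n z = (\<Sum>k\<le>n. c n k *\<^sub>R (T ^^ k) z)" for n z
  define L where "L n = (\<Sum>k\<le>n. \<bar>c n k - c n (k + 1)\<bar>)" for n
  have L: "L \<longlonglongrightarrow> 0"
  proof -
    have "(\<Sum>k. \<bar>c n k - c n (k + 1)\<bar>) = L n" for n
      unfolding L_def by (rule suminf_finite) (auto simp: zero)
    then show ?thesis using Lorentz by simp
  qed
  have lin: "linear (T ^^ k)" for k
    by (induction k) (simp_all only: funpow.simps linear_id linear_compose[OF _ T(2)])
  have A_add: "A n (u + v) = A n u + A n v" for n u v
    by (simp add: A_def linear_add[OF lin] scaleR_add_right sum.distrib)
  have power_le: "norm ((T ^^ k) z) \<le> norm z" for k z
    by (induction k) (auto intro: order_trans nonexpansive_linear_norm_le[OF T])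
  have A_le: "norm (A n z) \<le> norm z" for n z
  proof -
    have "norm (A n z) \<le> (\<Sum>k\<le>n. norm (c n k *\<^sub>R (T ^^ k) z))"
      unfolding A_def by (rule norm_sum)
    also have "\<dots> \<le> (\<Sum>k\<le>n. c n k * norm z)"
      by (intro sum_mono) (simp add: nonneg mult_left_mono power_le)
    also have "\<dots> = norm z" by (simp add: sum1 flip: sum_distrib_right)
    finally show ?thesis .
  qed
  have A_range: "norm (A n (w - T w)) \<le> 2 * L n * norm w" for n w
  proof -
    let ?z = "\<lambda>k. (T ^^ k) w"
    have "A n (w - T w) = (\<Sum>k\<le>n. c n k *\<^sub>R (?z k - ?z (Suc k)))"
      unfolding A_def by (simp add: linear_diff[OF lin] funpow_swap1)
    also have "\<dots> = c n 0 *\<^sub>R w - (\<Sum>k\<le>n. (c n k - c n (Suc k)) *\<^sub>R ?z (Suc k))"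
      by (subst sum_scaleR_by_parts) (simp add: zero)
    also have "norm \<dots> \<le> c n 0 * norm w + L n * norm w"
    proof (rule norm_triangle_le_diff, rule add_mono)
      show "norm (c n 0 *\<^sub>R w) \<le> c n 0 * norm w" by (simp add: nonneg)
      show "norm (\<Sum>k\<le>n. (c n k - c n (Suc k)) *\<^sub>R ?z (Suc k)) \<le> L n * norm w"
        unfolding L_def sum_distrib_right
      proof (rule sum_norm_le)
        fix k
        show "norm ((c n k - c n (Suc k)) *\<^sub>R ?z (Suc k)) \<le> \<bar>c n k - c n (k + 1)\<bar> * norm w"
          using power_le[of "Suc k" w] by (simp add: mult_left_mono del: funpow.simps)
      qed
    qed
    \<comment> \<open>The boundary term is controlled by the same sum, because the row ends in zero.\<close>
    also have "c n 0 \<le> L n"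
    proof -
      have "c n 0 = (\<Sum>k\<le>n. c n k - c n (k + 1))"
        using sum_telescope[of "c n" n] by (simp add: zero)
      then show ?thesis
        unfolding L_def by (metis (no_types, lifting) abs_ge_self sum_mono)
    qed
    finally show ?thesis by (simp add: mult_right_mono algebra_simps)
  qed
  define p where "p = orth_proj (Fix T) x"
  have "T p = p"
    using hilbert_fixed_point_decomposition(1)[OF T, of x] by (simp add: p_def Fix_def)
  then have "(T ^^ k) p = p" for k by (induction k) auto
  then have A_p: "A n p = p" for n
    by (simp add: A_def sum1 flip: scaleR_sum_left)
  have "(\<lambda>n. A n (x - p)) \<longlonglongrightarrow> 0"
  proof (rule LIMSEQ_I)
    fix e :: real assume e: "e > 0"
    have "x - p \<in> closure (range (\<lambda>w. w - T w))"
      using hilbert_fixed_point_decomposition(2)[OF T] by (simp add: p_def)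
    then obtain w where w: "norm ((x - p) - (w - T w)) < e / 2"
      using e unfolding closure_approachable dist_norm
      by (metis (no_types, lifting) half_gt_zero imageE norm_minus_commute)
    have "(\<lambda>n. 2 * L n * norm w) \<longlonglongrightarrow> 2 * 0 * norm w"
      by (intro tendsto_intros L)
    then have "\<forall>\<^sub>F n in sequentially. 2 * L n * norm w < e / 2"
      using e by (intro order_tendstoD) auto
    then obtain N where N: "\<And>n. n \<ge> N \<Longrightarrow> 2 * L n * norm w < e / 2"
      unfolding eventually_sequentially by blast
    have "norm (A n (x - p) - 0) < e" if "n \<ge> N" for n
    proof -
      have "A n (x - p) = A n ((x - p) - (w - T w)) + A n (w - T w)"
        by (simp flip: A_add)
      then have "norm (A n (x - p)) \<le> norm (A n ((x - p) - (w - T w))) + norm (A n (w - T w))"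
        by (metis norm_triangle_ineq)
      also have "\<dots> < e / 2 + e / 2"
        using A_le[of n "(x - p) - (w - T w)"] A_range[of n w] w N[OF that] by linarith
      finally show ?thesis by simp
    qed
    then show "\<exists>N. \<forall>n\<ge>N. norm (A n (x - p) - 0) < e" by blast
  qed
  then have "(\<lambda>n. A n (x - p) + p) \<longlonglongrightarrow> 0 + p"
    by (intro tendsto_intros)
  moreover have "A n (x - p) + p = A n x" for n
    using A_add[of n "x - p" p] by (simp add: A_p)
  ultimately show ?thesis by (simp add: A_def p_def)
qed

section \<open>The accelerated iteration\<close>

lemma bn_iter_fixed_point: "T x = x \<Longrightarrow> bn_iter \<alpha> T x n = x"
proof (induction n rule: less_induct)
  case (less n)
  then show ?case
    by (cases "(\<alpha>, T, x, n)" rule: bn_iter.cases)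
      (simp_all add: Let_def flip: scaleR_add_left)
qed

text \<open>For the identity on the real line the iterates are constant, and their expansion in powers
  of \<open>T\<close> is the row sum.\<close>

lemma sum_bn_coeff:
  assumes "\<alpha> > 0"
  shows "(\<Sum>k\<le>n. bn_coeff \<alpha> n k) = 1"
  using bn_iter_eq_sum_bn_coeff[OF linear_id assms, of "1::real" n]
  by (simp add: bn_iter_fixed_point)

theorem theorem5p5:
  shows "(\<lambda>n. \<Sum>k. \<bar>bn_coeff 4 n k - bn_coeff 4 n (k + 1)\<bar>) \<longlonglongrightarrow> 0 \<and>
    (\<forall>(T :: 'a::{real_inner, complete_space} \<Rightarrow> 'a) x\<^sub>0.
       nonexpansive T \<longrightarrow> linear T \<longrightarrow>
       bn_iter 4 T x\<^sub>0 \<longlonglongrightarrow> orth_proj (Fix T) x\<^sub>0)"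
proof (intro conjI allI impI)
  show "(\<lambda>n. \<Sum>k. \<bar>bn_coeff 4 n k - bn_coeff 4 n (k + 1)\<bar>) \<longlonglongrightarrow> 0"
    by (rule bn_coeff_4_Lorentz)
next
  fix T :: "'a \<Rightarrow> 'a" and x\<^sub>0
  assume T: "nonexpansive T" "linear T"
  (* The coefficients of row n belong to the iterate of index n + 1. *)
  have "(\<lambda>n. bn_iter 4 T x\<^sub>0 (n + 1)) \<longlonglongrightarrow> orth_proj (Fix T) x\<^sub>0"
    using mean_ergodic_Lorentz[OF T bn_coeff_4_nonneg bn_coeff_eq_0 sum_bn_coeff
        bn_coeff_4_Lorentz, of x\<^sub>0]
    by (subst bn_iter_eq_sum_bn_coeff[OF T(2)]) simp_all
  then show "bn_iter 4 T x\<^sub>0 \<longlonglongrightarrow> orth_proj (Fix T) x\<^sub>0"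
    using LIMSEQ_offset by blast
qed

end
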